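(* Let $d\in(0,1)$, let $F\in SR_d^2(0+)$ be a (deterministic) function of smooth variation of index $d$ at the diagonal, and let $\{X(t)\}_{t\ge 0}$ be a semimartingale with $X(0)=0$ $P$-a.s. Define $$M(t)=\int_0^t F(t,r)\,dX(r),\qquad t\ge 0 .$$ Then, $P$-a.s., $$\lim_{h\downarrow 0}\frac{M(s+h)-M(s)}{F(s+h,s)}=\Delta_X(s)\qquad\text{for all } s\in[0,1],$$ where $\Delta_X(s)=X(s)-X(s-)$.
   Context: Notation: $f^{(n,m)}(s,r)=\partial^{n+m}f(s,r)/\partial s^n\partial r^m$. Let $E=\{(s,r):-\infty<r\le s<\infty\}$ and $\tilde E=\{(s,r):-\infty<r<s<\infty\}$. $\mathbb{C}_+^{(k)}(E)$ is the space of functions $f:E\to\mathbb{R}$ that are continuous on $E$, have continuous partial derivatives of order $k$ on $\tilde E$, and are strictly positive on $\tilde E$. Functions of smooth variation: for $\rho>0$, $f\in SR_\rho^2(0+)$ means $f\in\mathbb{C}_+^{(2)}(E)$ and for every compact $K\subset\mathbb{R}$: (a) $\lim_{h\downarrow0}\sup_{t\in K}\big|\frac{h f^{(0,1)}(t,t-h)}{f(t,t-h)}+\rho\big|=0$; (b) $\lim_{h\downarrow0}\sup_{t\in K}\big|\frac{h f^{(1,0)}(t+h,t)}{f(t+h,t)}-\rho\big|=0$; (c) $\lim_{h\downarrow0}\sup_{t\in K}\big|\frac{h^2 f^{(1,1)}(t,t-h)}{f(t,t-h)}+\rho(\rho-1)\big|=0$; (d) $\lim_{h\downarrow0}\sup_{t\in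 K}\big|\frac{h^2 f^{(0,2)}(t,t-h)}{f(t,t-h)}-\rho(\rho-1)\big|=0$. Such $f$ satisfies $f(t,t)=0$ for all $t$. Conventions: semimartingales have càdlàg paths; $X(0)=0$ $P$-a.s. and $X(0-)=0$ by convention. Since for each $t$ the stochastic integral is defined only up to a null set, $M$ denotes the version for which, $P$-a.s., $M(t)=-\int_0^t F^{(0,1)}(t,r)X(r)\,dr$ for all $t\ge0$ simultaneously (for each fixed $t$ this equals the stochastic integral $P$-a.s.). *)

theory Defs
  imports "HOL-Probability.Probability"
begin

section \<open>Functions of smooth variation at the diagonal\<close>

definition dom_E :: "(real \<times> real) set" where
  "dom_E = {(s, r). r \<le> s}"

definition dom_E_open :: "(real \<times> real) set" where
  "dom_E_open = {(s, r). r < s}"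

text \<open>\<open>partial n m f s r\<close> is \<open>f\<^sup>(\<^sup>n\<^sup>,\<^sup>m\<^sup>) (s, r)\<close>: differentiate \<open>m\<close> times in the second argument,
  then \<open>n\<close> times in the first. Functions on \<open>dom_E\<close> are total functions in Isabelle; since
  \<open>dom_E_open\<close> is open, the derivatives at its points do not depend on values outside \<open>dom_E\<close>.\<close>

definition partial :: "nat \<Rightarrow> nat \<Rightarrow> (real \<Rightarrow> real \<Rightarrow> real) \<Rightarrow> real \<Rightarrow> real \<Rightarrow> real" where
  "partial n m f s r = (deriv ^^ n) (\<lambda>u. (deriv ^^ m) (f u) r) s"

text \<open>The differentiability clauses guarantee that each \<open>deriv\<close> occurring in \<open>partial n m f\<close>,
  \<open>n + m \<le> k\<close>, is a genuine derivative. The derivatives taken in another order then exist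
  and agree with these by Schwarz's theorem, so this is \<open>C\<^sup>k\<close> on \<open>dom_E_open\<close>.\<close>

definition C_plus :: "nat \<Rightarrow> (real \<Rightarrow> real \<Rightarrow> real) set" where
  "C_plus k = {f.
     continuous_on dom_E (\<lambda>(s, r). f s r) \<and>
     (\<forall>m<k. \<forall>(s, r)\<in>dom_E_open. partial 0 m f s differentiable (at r)) \<and>
     (\<forall>n m. n + m < k \<longrightarrow> (\<forall>(s, r)\<in>dom_E_open. (\<lambda>u. partial n m f u r) differentiable (at s))) \<and>
     (\<forall>n m. n + m \<le> k \<longrightarrow> continuous_on dom_E_open (\<lambda>(s, r). partial n m f s r)) \<and>
     (\<forall>(s, r)\<in>dom_E_open. 0 < f s r)}"

text \<open>The suprema are taken in \<open>ennreal\<close>, where they always exist and the supremum over the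
  empty set is \<open>0\<close>.\<close>

definition sup_abs_to_0 :: "real set \<Rightarrow> (real \<Rightarrow> real \<Rightarrow> real) \<Rightarrow> bool" where
  "sup_abs_to_0 K g \<longleftrightarrow> ((\<lambda>h. SUP t\<in>K. ennreal \<bar>g h t\<bar>) \<longlongrightarrow> 0) (at_right 0)"

definition SR2 :: "real \<Rightarrow> (real \<Rightarrow> real \<Rightarrow> real) set" where
  "SR2 \<rho> = {f. f \<in> C_plus 2 \<and> (\<forall>K. compact K \<longrightarrow>
     sup_abs_to_0 K (\<lambda>h t. h * partial 0 1 f t (t - h) / f t (t - h) + \<rho>) \<and>
     sup_abs_to_0 K (\<lambda>h t. h * partial 1 0 f (t + h) t / f (t + h) t - \<rho>) \<and>
     sup_abs_to_0 K (\<lambda>h t. h\<^sup>2 * partial 1 1 f t (t - h) / f t (t - h) + \<rho> * (\<rho> - 1)) \<and>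
     sup_abs_to_0 K (\<lambda>h t. h\<^sup>2 * partial 0 2 f t (t - h) / f t (t - h) - \<rho> * (\<rho> - 1)))}"


section \<open>Semimartingales\<close>

text \<open>Time is \<open>[0, \<infinity>)\<close>, encoded in \<open>real\<close>. The values of a process at negative times are
  never used, and the members of the filtration at negative times are irrelevant because all
  stopping times below are nonnegative.\<close>

definition filtered_prob_space :: "'a measure \<Rightarrow> (real \<Rightarrow> 'a measure) \<Rightarrow> bool" where
  "filtered_prob_space P \<F> \<longleftrightarrow>
     prob_space P \<and> filtration (space P) \<F> \<and> (\<forall>t. subalgebra P (\<F> t))"

definition adapted :: "(real \<Rightarrow> 'a measure) \<Rightarrow> (real \<Rightarrow> 'a \<Rightarrow> real) \<Rightarrow> bool" where
  "adapted \<F> X \<longleftrightarrow> (\<forall>t\<ge>0. X t \<in> borel_measurable (\<F> t))"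

definition cadlag :: "(real \<Rightarrow> real) \<Rightarrow> bool" where
  "cadlag x \<longleftrightarrow> (\<forall>t\<ge>0. (x \<longlongrightarrow> x t) (at_right t)) \<and> (\<forall>t>0. \<exists>l. (x \<longlongrightarrow> l) (at_left t))"

text \<open>The convention \<open>x (0-) = 0\<close> is built in.\<close>

definition left_limit :: "(real \<Rightarrow> real) \<Rightarrow> real \<Rightarrow> real" where
  "left_limit x s = (if s \<le> 0 then 0 else Lim (at_left s) x)"

definition jump :: "(real \<Rightarrow> real) \<Rightarrow> real \<Rightarrow> real" where
  "jump x s = x s - left_limit x s"

definition martingale :: "'a measure \<Rightarrow> (real \<Rightarrow> 'a measure) \<Rightarrow> (real \<Rightarrow> 'a \<Rightarrow> real) \<Rightarrow> bool" where
  "martingale P \<F> N \<longleftrightarrow> adapted \<F> N \<and> (\<forall>t\<ge>0. integrable P (N t)) \<and>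
     (\<forall>s t. 0 \<le> s \<and> s \<le> t \<longrightarrow> (AE \<omega> in P. real_cond_exp P (\<F> s) (N t) \<omega> = N s \<omega>))"

text \<open>The localizing times are real-valued: a localizing sequence \<open>T n\<close> with values in
  \<open>[0, \<infinity>]\<close> can always be replaced by \<open>min (T n) n\<close>.\<close>

definition local_martingale ::
    "'a measure \<Rightarrow> (real \<Rightarrow> 'a measure) \<Rightarrow> (real \<Rightarrow> 'a \<Rightarrow> real) \<Rightarrow> bool" where
  "local_martingale P \<F> L \<longleftrightarrow> adapted \<F> L \<and> (AE \<omega> in P. cadlag (\<lambda>t. L t \<omega>)) \<and>
     (\<exists>T :: nat \<Rightarrow> 'a \<Rightarrow> real.
        (\<forall>n. stopping_time \<F> (T n) \<and> (\<forall>\<omega>\<in>space P. 0 \<le> T n \<omega>)) \<and>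
        (AE \<omega> in P. incseq (\<lambda>n. T n \<omega>) \<and> filterlim (\<lambda>n. T n \<omega>) at_top sequentially) \<and>
        (\<forall>n. martingale P \<F>
               (\<lambda>t \<omega>. L (min t (T n \<omega>)) \<omega> * indicator {\<omega>. 0 < T n \<omega>} \<omega>)))"

definition finite_variation :: "(real \<Rightarrow> real) \<Rightarrow> bool" where
  "finite_variation x \<longleftrightarrow> (\<forall>t\<ge>0.
     bdd_above {(\<Sum>i<n. \<bar>x (\<tau> (Suc i)) - x (\<tau> i)\<bar>) | n (\<tau> :: nat \<Rightarrow> real).
       mono \<tau> \<and> range \<tau> \<subseteq> {0..t}})"

definition finite_variation_process ::
    "'a measure \<Rightarrow> (real \<Rightarrow> 'a measure) \<Rightarrow> (real \<Rightarrow> 'a \<Rightarrow> real) \<Rightarrow> bool" where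
  "finite_variation_process P \<F> A \<longleftrightarrow> adapted \<F> A \<and>
     (AE \<omega> in P. cadlag (\<lambda>t. A t \<omega>) \<and> finite_variation (\<lambda>t. A t \<omega>))"

definition semimartingale ::
    "'a measure \<Rightarrow> (real \<Rightarrow> 'a measure) \<Rightarrow> (real \<Rightarrow> 'a \<Rightarrow> real) \<Rightarrow> bool" where
  "semimartingale P \<F> X \<longleftrightarrow> adapted \<F> X \<and> (AE \<omega> in P. cadlag (\<lambda>t. X t \<omega>)) \<and>
     (\<exists>L A. local_martingale P \<F> L \<and> finite_variation_process P \<F> A \<and>
        (AE \<omega> in P. L 0 \<omega> = 0 \<and> A 0 \<omega> = 0 \<and>
           (\<forall>t\<ge>0. X t \<omega> = X 0 \<omega> + L t \<omega> + A t \<omega>)))"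


section \<open>The stochastic integral\<close>

text \<open>A simple predictable process is
  \<open>h0 1\<^bsub>{0}\<^esub>(t) + (\<Sum>i<n. h i 1\<^bsub>(T i, T (i + 1)]\<^esub>(t))\<close>, given by the data \<open>n\<close>, \<open>h0\<close>, \<open>T\<close>, \<open>h\<close>.\<close>

definition simple_predictable ::
    "'a measure \<Rightarrow> (real \<Rightarrow> 'a measure) \<Rightarrow>
     nat \<Rightarrow> ('a \<Rightarrow> real) \<Rightarrow> (nat \<Rightarrow> 'a \<Rightarrow> real) \<Rightarrow> (nat \<Rightarrow> 'a \<Rightarrow> real) \<Rightarrow> bool" where
  "simple_predictable P \<F> n h0 T h \<longleftrightarrow>
     h0 \<in> borel_measurable (\<F> 0) \<and>
     (\<forall>i\<le>n. stopping_time \<F> (T i)) \<and>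
     (\<forall>\<omega>\<in>space P. T 0 \<omega> = 0 \<and> (\<forall>i<n. T i \<omega> \<le> T (Suc i) \<omega>)) \<and>
     (\<forall>i<n. h i \<in> borel_measurable (filtration.pre_sigma (space P) \<F> (T i)))"

definition simple_process ::
    "nat \<Rightarrow> ('a \<Rightarrow> real) \<Rightarrow> (nat \<Rightarrow> 'a \<Rightarrow> real) \<Rightarrow> (nat \<Rightarrow> 'a \<Rightarrow> real) \<Rightarrow> real \<Rightarrow> 'a \<Rightarrow> real" where
  "simple_process n h0 T h t \<omega> =
     h0 \<omega> * indicator {0} t + (\<Sum>i<n. h i \<omega> * indicator {T i \<omega> <.. T (Suc i) \<omega>} t)"

definition simple_integral ::
    "nat \<Rightarrow> ('a \<Rightarrow> real) \<Rightarrow> (nat \<Rightarrow> 'a \<Rightarrow> real) \<Rightarrow> (nat \<Rightarrow> 'a \<Rightarrow> real) \<Rightarrow>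
     (real \<Rightarrow> 'a \<Rightarrow> real) \<Rightarrow> real \<Rightarrow> 'a \<Rightarrow> real" where
  "simple_integral n h0 T h X t \<omega> =
     h0 \<omega> * X 0 \<omega> +
     (\<Sum>i<n. h i \<omega> * (X (min t (T (Suc i) \<omega>)) \<omega> - X (min t (T i \<omega>)) \<omega>))"

definition to_0_in_prob :: "'a measure \<Rightarrow> (nat \<Rightarrow> 'a \<Rightarrow> ennreal) \<Rightarrow> bool" where
  "to_0_in_prob P D \<longleftrightarrow> (\<forall>k. D k \<in> borel_measurable P) \<and>
     (\<forall>\<epsilon>>0. (\<lambda>k. measure P {\<omega>\<in>space P. ennreal \<epsilon> < D k \<omega>}) \<longlonglongrightarrow> 0)"

text \<open>\<open>is_stoch_integral P \<F> X H t Y\<close>: the random variable \<open>Y\<close> is a version of the integral of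
  \<open>H\<close> with respect to \<open>X\<close> over \<open>[0, t]\<close>, defined by extension from simple predictable
  processes: \<open>H\<close> is the limit, uniformly on \<open>[0, t]\<close> in probability, of simple predictable
  processes whose integrals up to \<open>t\<close> converge to \<open>Y\<close> in probability. For a semimartingale \<open>X\<close>
  the limit does not depend on the approximating sequence.\<close>

definition is_stoch_integral ::
    "'a measure \<Rightarrow> (real \<Rightarrow> 'a measure) \<Rightarrow> (real \<Rightarrow> 'a \<Rightarrow> real) \<Rightarrow>
     (real \<Rightarrow> 'a \<Rightarrow> real) \<Rightarrow> real \<Rightarrow> ('a \<Rightarrow> real) \<Rightarrow> bool" where
  "is_stoch_integral P \<F> X H t Y \<longleftrightarrow>
     (\<exists>n h0 T h.
        (\<forall>k. simple_predictable P \<F> (n k) (h0 k) (T k) (h k)) \<and>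
        to_0_in_prob P (\<lambda>k \<omega>. SUP r\<in>{0..t}.
          ennreal \<bar>simple_process (n k) (h0 k) (T k) (h k) r \<omega> - H r \<omega>\<bar>) \<and>
        to_0_in_prob P (\<lambda>k \<omega>.
          ennreal \<bar>simple_integral (n k) (h0 k) (T k) (h k) X t \<omega> - Y \<omega>\<bar>))"

end

theory Submission
  imports Defs "HOL-Real_Asymp.Real_Asymp"
begin

text \<open>
  The limit holds path by path. Fix a cadlag path \<open>x\<close> and put
  \<open>m t = - \<integral>\<^bsub>[0,t)\<^esub> F01 t r * x r dr\<close>, where \<open>F01\<close> is the derivative of \<open>F\<close> in its second
  argument and \<open>F11\<close> the mixed derivative. Splitting \<open>[0, s + h)\<close> at \<open>s\<close> gives
  \<open>m (s + h) - m s = - R - L\<close> with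
  \<open>R = \<integral>\<^bsub>[s,s+h)\<^esub> F01 (s + h) r * x r dr\<close> and
  \<open>L = \<integral>\<^bsub>[0,s)\<^esub> (F01 (s + h) r - F01 s r) * x r dr\<close>.
  Divided by \<open>F (s + h) s\<close>, the first tends to \<open>- x s\<close> (\<open>recent_past_limit\<close>) and the second
  to the left limit of \<open>x\<close> at \<open>s\<close> (\<open>remote_past_limit\<close>), whence the jump.

  Both limits rest on the same mechanism: near the diagonal the two kernels have a constant sign,
  so that the fundamental theorem of calculus computes not only their integrals but also the
  integrals of their absolute values, and replacing \<open>x\<close> by its one-sided limit at \<open>s\<close> costs only a
  small multiple of \<open>F (s + h) s\<close>. Smooth variation provides the signs
  (\<open>signs_near_diagonal\<close>): the scaled limits of \<open>F01\<close> and \<open>F11\<close> are \<open>- d < 0\<close> and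
  \<open>d * (1 - d) > 0\<close>, uniformly on compact sets.

  What happens at a positive distance from the diagonal changes by \<open>O(h)\<close>, because the kernel is
  continuously differentiable there. This is negligible because \<open>F (s + h) s\<close> decays more slowly
  than \<open>h\<close> when \<open>d < 1\<close> (\<open>increment_negligible\<close>). The boundary terms on the diagonal vanish since
  \<open>F t t = 0\<close> (\<open>F_diagonal\<close>). These two facts come from integrating the logarithmic derivative
  of \<open>F\<close> along the lines \<open>F t (t - h)\<close> and \<open>F (s + h) s\<close>.
\<close>

section \<open>Power bounds from elasticities\<close>

text \<open>
  The elasticity \<open>u * g' u / g u\<close> is the derivative of \<open>ln g\<close> with respect to \<open>ln u\<close>. If it is at
  most \<open>b\<close>, then \<open>ln (g u) - b * ln u\<close> is nonincreasing, so \<open>g\<close> is bounded below near \<open>0\<close> by a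
  multiple of the power \<open>b\<close>.
\<close>

lemma elasticity_le_imp_powr_bound:
  fixes g g' :: "real \<Rightarrow> real"
  assumes hk: "0 < h" "h \<le> k"
    and pos: "\<And>u. 0 < u \<Longrightarrow> u \<le> k \<Longrightarrow> 0 < g u"
    and deriv: "\<And>u. 0 < u \<Longrightarrow> u \<le> k \<Longrightarrow> (g has_real_derivative g' u) (at u)"
    and le: "\<And>u. 0 < u \<Longrightarrow> u \<le> k \<Longrightarrow> u * g' u / g u \<le> b"
  shows "g k * (h / k) powr b \<le> g h"
proof -
  have "ln (g k) - b * ln k \<le> ln (g h) - b * ln h"
  proof (rule DERIV_nonpos_imp_nonincreasing[OF hk(2)])
    fix u assume "h \<le> u" "u \<le> k"
    then have u: "0 < u" "u \<le> k" using hk by auto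
    have "((\<lambda>u. ln (g u) - b * ln u) has_real_derivative g' u / g u - b / u) (at u)"
      using u pos[OF u] by (auto intro!: derivative_eq_intros deriv simp: field_simps)
    moreover have "g' u / g u - b / u \<le> 0"
      using le[OF u] u by (simp add: field_simps)
    ultimately show "\<exists>y. ((\<lambda>u. ln (g u) - b * ln u) has_real_derivative y) (at u) \<and> y \<le> 0"
      by blast
  qed
  then have "ln (g k * (h / k) powr b) \<le> ln (g h)"
    using hk pos[of k] by (simp add: ln_mult ln_powr ln_div algebra_simps)
  then show ?thesis using hk pos[of k] pos[of h] by (subst (asm) ln_le_cancel_iff) auto
qed

text \<open>
  Passing to \<open>1 / g\<close> changes the sign of the elasticity.
\<close>

lemma elasticity_ge_imp_powr_bound:
  fixes g g' :: "real \<Rightarrow> real"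
  assumes hk: "0 < h" "h \<le> k"
    and pos: "\<And>u. 0 < u \<Longrightarrow> u \<le> k \<Longrightarrow> 0 < g u"
    and deriv: "\<And>u. 0 < u \<Longrightarrow> u \<le> k \<Longrightarrow> (g has_real_derivative g' u) (at u)"
    and ge: "\<And>u. 0 < u \<Longrightarrow> u \<le> k \<Longrightarrow> a \<le> u * g' u / g u"
  shows "g h \<le> g k * (h / k) powr a"
proof -
  have "inverse (g k) * (h / k) powr (- a) \<le> inverse (g h)"
  proof (rule elasticity_le_imp_powr_bound[OF hk])
    fix u assume u: "0 < u" "u \<le> k"
    show "0 < inverse (g u)" using pos[OF u] by simp
    show "((\<lambda>u. inverse (g u)) has_real_derivative - (g' u / g u) / g u) (at u)"
      using pos[OF u] by (auto intro!: derivative_eq_intros deriv u simp: field_simps)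
    show "u * (- (g' u / g u) / g u) / inverse (g u) \<le> - a"
      using ge[OF u] pos[OF u] by (simp add: field_simps)
  qed
  then show ?thesis
    using pos[of h] pos[of k] hk by (simp add: powr_minus field_simps)
qed

section \<open>Kernels of smooth variation\<close>

lemma sup_abs_to_0_eventually:
  assumes "sup_abs_to_0 K g" "0 < e"
  shows "\<forall>\<^sub>F h in at_right 0. \<forall>t\<in>K. \<bar>g h t\<bar> < e"
proof -
  have "\<forall>\<^sub>F h in at_right 0. (SUP t\<in>K. ennreal \<bar>g h t\<bar>) < ennreal e"
    using assms by (intro order_tendstoD) (auto simp: sup_abs_to_0_def)
  then show ?thesis
  proof (eventually_elim, intro ballI)
    fix h t assume *: "(SUP t\<in>K. ennreal \<bar>g h t\<bar>) < ennreal e" and "t \<in> K"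
    then have "ennreal \<bar>g h t\<bar> \<le> (SUP t\<in>K. ennreal \<bar>g h t\<bar>)"
      by (intro SUP_upper)
    with * have "ennreal \<bar>g h t\<bar> < ennreal e" by (rule le_less_trans[rotated])
    then show "\<bar>g h t\<bar> < e" by (simp add: ennreal_less_iff)
  qed
qed

locale smooth_variation =
  fixes F :: "real \<Rightarrow> real \<Rightarrow> real" and d :: real
  assumes d: "0 < d" "d < 1" and F: "F \<in> SR2 d"
begin

abbreviation "F01 \<equiv> partial 0 1 F"
abbreviation "F10 \<equiv> partial 1 0 F"
abbreviation "F11 \<equiv> partial 1 1 F"

lemma F_C2: "F \<in> C_plus 2"
  using F by (simp add: SR2_def)

lemma F_pos: "r < s \<Longrightarrow> 0 < F s r"
  using F_C2 by (auto simp: C_plus_def dom_E_open_def)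

lemma F_continuous: "continuous_on dom_E (\<lambda>(s, r). F s r)"
  using F_C2 by (auto simp: C_plus_def)

lemma partial_continuous:
  "n + m \<le> 2 \<Longrightarrow> continuous_on dom_E_open (\<lambda>(s, r). partial n m F s r)"
  using F_C2 by (auto simp: C_plus_def)

lemma F_deriv_snd: "r < s \<Longrightarrow> (F s has_real_derivative F01 s r) (at r)"
proof -
  assume "r < s"
  then have "partial 0 0 F s differentiable (at r)"
    using F_C2 by (auto simp: C_plus_def dom_E_open_def)
  then show ?thesis by (simp add: partial_def[abs_def] DERIV_deriv_iff_real_differentiable)
qed

lemma partial_deriv_fst:
  assumes "n + m < 2" "r < s"
  shows "((\<lambda>u. partial n m F u r) has_real_derivative partial (Suc n) m F s r) (at s)"
proof -
  have "(\<lambda>u. partial n m F u r) differentiable (at s)"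
    using F_C2 assms by (auto simp: C_plus_def dom_E_open_def)
  then show ?thesis by (simp add: partial_def flip: DERIV_deriv_iff_real_differentiable)
qed

lemma F_deriv_fst: "r < s \<Longrightarrow> ((\<lambda>u. F u r) has_real_derivative F10 s r) (at s)"
  using partial_deriv_fst[of 0 0] by (simp add: partial_def)

lemma F01_deriv_fst: "r < s \<Longrightarrow> ((\<lambda>u. F01 u r) has_real_derivative F11 s r) (at s)"
  using partial_deriv_fst[of 0 1] by simp

lemma F_continuous_snd: "continuous_on {..t} (F t)"
  by (rule continuous_on_compose2[OF F_continuous, of _ "\<lambda>r. (t, r)", simplified])
     (auto intro!: continuous_intros simp: dom_E_def)

lemma F01_continuous_snd: "continuous_on {..<t} (F01 t)"
proof -
  have "continuous_on {..<t} (\<lambda>r. case (t, r) of (s, r) \<Rightarrow> F01 s r)"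
    by (rule continuous_on_compose2[OF partial_continuous])
       (auto intro!: continuous_intros simp: dom_E_open_def)
  then show ?thesis by simp
qed

text \<open>
  As a function of \<open>h\<close>, \<open>F t (t - h)\<close> has elasticity at least \<open>d / 2 > 0\<close> near \<open>0\<close>, so it is
  dominated by a multiple of \<open>h powr (d / 2)\<close>; continuity up to the diagonal does the rest.
\<close>

lemma F_diagonal: "F t t = 0"
proof -
  have "\<forall>\<^sub>F h in at_right 0. \<forall>t\<in>{t}. \<bar>h * F01 t (t - h) / F t (t - h) + d\<bar> < d / 2"
    using F d by (intro sup_abs_to_0_eventually) (auto simp: SR2_def)
  then obtain b where b: "0 < b"
    "\<And>h. 0 < h \<Longrightarrow> h < b \<Longrightarrow> \<bar>h * F01 t (t - h) / F t (t - h) + d\<bar> < d / 2"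
    by (auto simp: eventually_at_right_field)
  define k where "k = b / 2"
  have k: "0 < k" "k < b" using b by (auto simp: k_def)
  have le: "F t (t - h) \<le> F t (t - k) * (h / k) powr (d / 2)" if "0 < h" "h \<le> k" for h
  proof (rule elasticity_ge_imp_powr_bound[where g' = "\<lambda>h. - F01 t (t - h)", OF that])
    fix u assume u: "0 < u" "u \<le> k"
    show "0 < F t (t - u)" using u by (intro F_pos) auto
    show "((\<lambda>h. F t (t - h)) has_real_derivative - F01 t (t - u)) (at u)"
    proof -
      have "((\<lambda>h. t - h) has_real_derivative - 1) (at u)"
        by (auto intro!: derivative_eq_intros)
      moreover have "(F t has_real_derivative F01 t (t - u)) (at (t - u))"
        using u by (intro F_deriv_snd) auto
      ultimately show ?thesis using DERIV_chain'[of "\<lambda>h. t - h" "- 1" u UNIV "F t"] by simp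
    qed
    show "d / 2 \<le> u * - F01 t (t - u) / F t (t - u)"
      using b(2)[of u] u k by (auto simp: abs_if split: if_splits)
  qed
  have "\<forall>\<^sub>F h in at_right 0. 0 \<le> F t (t - h)"
    using k F_pos[of "t - _" t] by (auto simp: eventually_at_right_field intro!: exI[of _ k] less_imp_le)
  moreover have "\<forall>\<^sub>F h in at_right 0. F t (t - h) \<le> F t (t - k) * (h / k) powr (d / 2)"
    using k le by (auto simp: eventually_at_right_field intro!: exI[of _ k])
  moreover have "((\<lambda>h. F t (t - k) * (h / k) powr (d / 2)) \<longlongrightarrow> 0) (at_right 0)"
    using k(1) d by real_asymp
  ultimately have "((\<lambda>h. F t (t - h)) \<longlongrightarrow> 0) (at_right 0)"
    by (rule tendsto_sandwich[OF _ _ tendsto_const])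
  moreover have "((\<lambda>h. F t (t - h)) \<longlongrightarrow> F t t) (at_right 0)"
  proof -
    have "continuous_on {0..} (\<lambda>h. F t (t - h))"
      by (intro continuous_on_compose2[OF F_continuous_snd]) (auto intro!: continuous_intros)
    then show ?thesis
      by (auto simp: continuous_on_def at_within_Ici_at_right dest!: bspec[of _ _ 0])
  qed
  ultimately show ?thesis
    using tendsto_unique[of "at_right (0::real)"] by simp
qed

text \<open>
  Since \<open>d < 1\<close>, some \<open>b\<close> satisfies \<open>d < b < 1\<close>, and the elasticity of \<open>F (s + h) s\<close> in \<open>h\<close> is
  eventually below \<open>b\<close>, so \<open>F (s + h) s\<close> is at least a multiple of \<open>h powr b\<close>, which dominates \<open>h\<close>.
\<close>

lemma increment_negligible: "((\<lambda>h. h / F (s + h) s) \<longlongrightarrow> 0) (at_right 0)"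
proof -
  define b where "b = (1 + d) / 2"
  have bd: "d < b" "b < 1" using d by (auto simp: b_def)
  have "\<forall>\<^sub>F h in at_right 0. \<forall>t\<in>{s}. \<bar>h * F10 (t + h) t / F (t + h) t - d\<bar> < b - d"
    using F bd by (intro sup_abs_to_0_eventually) (auto simp: SR2_def)
  then obtain c where c: "0 < c"
    "\<And>h. 0 < h \<Longrightarrow> h < c \<Longrightarrow> \<bar>h * F10 (s + h) s / F (s + h) s - d\<bar> < b - d"
    by (auto simp: eventually_at_right_field)
  define k where "k = c / 2"
  have k: "0 < k" "k < c" using c by (auto simp: k_def)
  have ge: "F (s + k) s * (h / k) powr b \<le> F (s + h) s" if "0 < h" "h \<le> k" for h
  proof (rule elasticity_le_imp_powr_bound[where g' = "\<lambda>h. F10 (s + h) s", OF that])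
    fix u assume u: "0 < u" "u \<le> k"
    show "0 < F (s + u) s" using u by (intro F_pos) auto
    show "((\<lambda>h. F (s + h) s) has_real_derivative F10 (s + u) s) (at u)"
      using u DERIV_shift[of "\<lambda>u. F u s" _ u s] F_deriv_fst[of s "s + u"] by (simp add: add.commute)
    show "u * F10 (s + u) s / F (s + u) s \<le> b"
      using c(2)[of u] u k by (auto simp: abs_if split: if_splits)
  qed
  define C where "C = F (s + k) s"
  have C: "0 < C" using k by (auto simp: C_def intro!: F_pos)
  have "\<forall>\<^sub>F h in at_right 0. 0 \<le> h / F (s + h) s"
    using k F_pos[of s] by (auto simp: eventually_at_right_field intro!: exI[of _ k] less_imp_le)
  moreover have "\<forall>\<^sub>F h in at_right 0. h / F (s + h) s \<le> h / (C * (h / k) powr b)"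
    using k C ge by (auto simp: eventually_at_right_field C_def intro!: exI[of _ k] divide_left_mono mult_pos_pos F_pos)
  moreover have "((\<lambda>h. h / (C * (h / k) powr b)) \<longlongrightarrow> 0) (at_right 0)"
    using k(1) C bd by real_asymp
  ultimately show ?thesis
    by (rule tendsto_sandwich[OF _ _ tendsto_const])
qed

text \<open>
  The scaled limits of \<open>F01\<close> and \<open>F11\<close> at the diagonal are \<open>- d\<close> and \<open>d * (1 - d)\<close>. The same \<open>\<eta>\<close>
  serves for all \<open>t \<in> K\<close>; this matters below, where \<open>t = s + h\<close> varies with \<open>h\<close>.
\<close>

lemma signs_near_diagonal:
  assumes "compact K"
  obtains \<eta> where "0 < \<eta>" "\<And>t r. t \<in> K \<Longrightarrow> t - \<eta> < r \<Longrightarrow> r < t \<Longrightarrow> F01 t r < 0"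
    "\<And>t r. t \<in> K \<Longrightarrow> t - \<eta> < r \<Longrightarrow> r < t \<Longrightarrow> 0 < F11 t r"
proof -
  have "0 < d * (1 - d)" using d by simp
  have "\<forall>\<^sub>F h in at_right 0. \<forall>t\<in>K. \<bar>h * F01 t (t - h) / F t (t - h) + d\<bar> < d"
    using F d assms by (intro sup_abs_to_0_eventually) (auto simp: SR2_def)
  then have "\<forall>\<^sub>F h in at_right 0. \<forall>t\<in>K. \<bar>h * F01 t (t - h) / F t (t - h) + d\<bar> < d \<and>
      \<bar>h\<^sup>2 * F11 t (t - h) / F t (t - h) + d * (d - 1)\<bar> < d * (1 - d)"
    using sup_abs_to_0_eventually[of K "\<lambda>h t. h\<^sup>2 * F11 t (t - h) / F t (t - h) + d * (d - 1)" "d * (1 - d)"]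
      F \<open>0 < d * (1 - d)\<close> assms by (auto simp: SR2_def elim: eventually_elim2)
  then obtain \<eta> where \<eta>: "0 < \<eta>"
    "\<And>h t. 0 < h \<Longrightarrow> h < \<eta> \<Longrightarrow> t \<in> K \<Longrightarrow> \<bar>h * F01 t (t - h) / F t (t - h) + d\<bar> < d"
    "\<And>h t. 0 < h \<Longrightarrow> h < \<eta> \<Longrightarrow> t \<in> K \<Longrightarrow>
       \<bar>h\<^sup>2 * F11 t (t - h) / F t (t - h) + d * (d - 1)\<bar> < d * (1 - d)"
    unfolding eventually_at_right_field by blast
  show thesis
  proof (rule that[OF \<eta>(1)])
    fix t r assume t: "t \<in> K" "t - \<eta> < r" "r < t"
    have "(t - r) * F01 t r / F t r < 0"
      using \<eta>(2)[of "t - r" t] t by (simp add: abs_less_iff)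
    then show "F01 t r < 0"
      using t F_pos[of r t] by (simp add: divide_less_0_iff mult_less_0_iff)
    have "d * (d - 1) = - (d * (1 - d))" by (simp add: algebra_simps)
    then have "0 < (t - r)\<^sup>2 * F11 t r / F t r"
      using \<eta>(3)[of "t - r" t] t by (simp add: abs_if split: if_splits)
    then show "0 < F11 t r"
      using t F_pos[of r t] by (simp add: zero_less_divide_iff zero_less_mult_iff)
  qed
qed

text \<open>
  For \<open>b = t\<close> the integrand is singular at the endpoint. The fundamental theorem of calculus still
  gives a gauge integral, since \<open>F t\<close> is continuous on \<open>[a, t]\<close> and differentiable inside. Being
  negative near \<open>t\<close>, \<open>F01 t\<close> is bounded above on \<open>[a, t)\<close>, and a gauge integrable function with an
  integrable upper bound is absolutely integrable.
\<close>

lemma F01_integral: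
  assumes "a \<le> b" "b \<le> t"
  shows "set_integrable lborel {a..<b} (F01 t)" (is ?int)
    and "(LBINT r:{a..<b}. F01 t r) = F t b - F t a" (is ?eq)
proof -
  have hk: "(F01 t has_integral F t b - F t a) {a..b}"
    using assms
    by (intro fundamental_theorem_of_calculus_interior continuous_on_subset[OF F_continuous_snd])
       (use F_deriv_snd in \<open>auto simp flip: has_real_derivative_iff_has_vector_derivative\<close>)
  obtain \<eta> where \<eta>: "0 < \<eta>" "\<And>r. t - \<eta> < r \<Longrightarrow> r < t \<Longrightarrow> F01 t r < 0"
    using signs_near_diagonal[of "{t}"] by (metis compact_sing singletonI)
  have "compact (F01 t ` {a..t - \<eta> / 2})"
    using \<eta>(1) by (intro compact_continuous_image continuous_on_subset[OF F01_continuous_snd]) auto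
  then obtain C where C: "\<forall>r\<in>{a..t - \<eta> / 2}. \<bar>F01 t r\<bar> \<le> C"
    by (auto dest!: compact_imp_bounded simp: bounded_iff)
  have ub: "F01 t r \<le> max C 0" if "a \<le> r" "r < b" for r
  proof (cases "r \<le> t - \<eta> / 2")
    case True
    then have "\<bar>F01 t r\<bar> \<le> C" using C that by simp
    then show ?thesis by linarith
  next
    case False
    then have "F01 t r < 0" using \<eta>(1) that assms by (intro \<eta>(2)) auto
    then show ?thesis by linarith
  qed
  have hk': "(F01 t has_integral F t b - F t a) {a..<b}"
  proof (rule has_integral_spike_set_eq[THEN iffD1, OF _ _ hk])
    show "negligible {r \<in> {a..b} - {a..<b}. F01 t r \<noteq> 0}"
      by (rule negligible_subset[of "{b}"]) auto
    show "negligible {r \<in> {a..<b} - {a..b}. F01 t r \<noteq> 0}"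
      by (rule negligible_subset[of "{}"]) auto
  qed
  have "F01 t absolutely_integrable_on {a..<b}"
  proof (rule absolutely_integrable_absolutely_integrable_ubound)
    show "F01 t integrable_on {a..<b}" using hk' by blast
    show "(\<lambda>_. max C 0) absolutely_integrable_on {a..<b}"
      by (rule set_integrable_subset[of _ "{a..b}"]) (auto intro!: absolutely_integrable_on_const)
  qed (use ub in auto)
  moreover have "(\<lambda>r. indicator {a..<b} r *\<^sub>R F01 t r) \<in> borel_measurable borel"
    using assms by (intro borel_measurable_continuous_on_indicator continuous_on_subset[OF F01_continuous_snd]) auto
  ultimately show ?int
    by (simp add: set_integrable_def integrable_completion)
  then show ?eq
    using set_borel_integral_eq_integral(2) hk' by (metis integral_unique)
qed

end

section \<open>Cadlag paths\<close>

text \<open>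
  A cadlag path is bounded near each point because of its one-sided limits; subdivision of the
  interval makes this global.
\<close>

lemma cadlag_bounded:
  assumes x: "cadlag x" and "0 \<le> T"
  obtains B where "0 \<le> B" "\<And>t. 0 \<le> t \<Longrightarrow> t \<le> T \<Longrightarrow> \<bar>x t\<bar> \<le> B"
proof -
  have "\<exists>B. \<forall>t\<in>{0..T}. 0 \<le> t \<longrightarrow> \<bar>x t\<bar> \<le> B"
  proof (rule Bolzano[where P = "\<lambda>u v. \<exists>B. \<forall>t\<in>{u..v}. 0 \<le> t \<longrightarrow> \<bar>x t\<bar> \<le> B"])
    fix a b c assume "\<exists>B. \<forall>t\<in>{a..b}. 0 \<le> t \<longrightarrow> \<bar>x t\<bar> \<le> B" "\<exists>B. \<forall>t\<in>{b..c}. 0 \<le> t \<longrightarrow> \<bar>x t\<bar> \<le> B"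
    then obtain B B' where "\<forall>t\<in>{a..b}. 0 \<le> t \<longrightarrow> \<bar>x t\<bar> \<le> B" "\<forall>t\<in>{b..c}. 0 \<le> t \<longrightarrow> \<bar>x t\<bar> \<le> B'"
      by blast
    then have "\<forall>t\<in>{a..c}. 0 \<le> t \<longrightarrow> \<bar>x t\<bar> \<le> max B B'"
      by (metis atLeastAtMost_iff linear max.coboundedI1 max.coboundedI2)
    then show "\<exists>B. \<forall>t\<in>{a..c}. 0 \<le> t \<longrightarrow> \<bar>x t\<bar> \<le> B" by blast
  next
    fix c assume c: "0 \<le> c" "c \<le> T"
    have "\<forall>\<^sub>F t in at_right c. dist (x t) (x c) < 1"
      using x c by (intro tendstoD) (auto simp: cadlag_def)
    then obtain b where b: "c < b" "\<And>t. c < t \<Longrightarrow> t < b \<Longrightarrow> dist (x t) (x c) < 1"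
      by (auto simp: eventually_at_right_field)
    obtain a l where a: "a < c" "\<And>t. 0 \<le> t \<Longrightarrow> a < t \<Longrightarrow> t < c \<Longrightarrow> dist (x t) l < 1"
    proof (cases "c = 0")
      case True
      then show thesis using that[of "c - 1"] by auto
    next
      case False
      then have "\<exists>l. (x \<longlongrightarrow> l) (at_left c)"
        using x c by (simp add: cadlag_def)
      then obtain l where "(x \<longlongrightarrow> l) (at_left c)" ..
      then have "\<forall>\<^sub>F t in at_left c. dist (x t) l < 1" by (intro tendstoD) auto
      then show thesis using that by (auto simp: eventually_at_left_field)
    qed
    have "\<bar>x t\<bar> \<le> \<bar>x c\<bar> + \<bar>l\<bar> + 1" if "0 \<le> t" "a < t" "t < b" for t
      using that a(2)[of t] b(2)[of t] by (cases t c rule: linorder_cases) (auto simp: dist_real_def)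
    then show "\<exists>\<delta>>0. \<forall>u v. u \<le> c \<and> c \<le> v \<and> v - u < \<delta> \<longrightarrow> (\<exists>B. \<forall>t\<in>{u..v}. 0 \<le> t \<longrightarrow> \<bar>x t\<bar> \<le> B)"
      using a(1) b(1) by (intro exI[of _ "min (b - c) (c - a)"]) (force intro!: exI[of _ "\<bar>x c\<bar> + \<bar>l\<bar> + 1"])
  qed (use assms in auto)
  then obtain B where "\<forall>t\<in>{0..T}. \<bar>x t\<bar> \<le> B" by auto
  then show thesis using that[of "max B 0"] by (auto simp: le_max_iff_disj)
qed

lemma cadlag_left_limit:
  assumes "cadlag x" "0 < s"
  shows "(x \<longlongrightarrow> left_limit x s) (at_left s)"
proof -
  obtain l where "(x \<longlongrightarrow> l) (at_left s)"
    using assms by (auto simp: cadlag_def)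
  then show ?thesis
    using assms tendsto_Lim[of "at_left s" x l] by (simp add: left_limit_def)
qed

text \<open>
  By right continuity \<open>x r\<close> is the limit of the values of \<open>x\<close> at the next point of the grid of mesh
  \<open>1 / (n + 1)\<close> strictly to the right of \<open>r\<close>, and these are functions of an integer part.
\<close>

lemma cadlag_measurable:
  assumes x: "cadlag x"
  shows "set_borel_measurable lborel {0..} x"
proof -
  define q where "q n r = (of_int \<lfloor>real (Suc n) * r\<rfloor> + 1) / real (Suc n)" for n and r :: real
  have "(\<lambda>r. indicator {0..} r *\<^sub>R x r) \<in> borel_measurable borel"
  proof (rule borel_measurable_LIMSEQ_real)
    fix r :: real
    show "(\<lambda>n. indicator {0..} r *\<^sub>R x (q n r)) \<longlonglongrightarrow> indicator {0..} r *\<^sub>R x r"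
    proof (cases "0 \<le> r")
      case True
      \<comment> \<open>the strict inequality puts the sample points in \<open>at_right r\<close>\<close>
      have gt: "r < q n r" for n
        unfolding q_def by (subst pos_less_divide_eq) (auto simp: mult.commute intro: floor_correct[THEN conjunct2])
      have le: "q n r \<le> r + 1 / real (Suc n)" for n
      proof -
        have "q n r \<le> (real (Suc n) * r + 1) / real (Suc n)"
          unfolding q_def by (intro divide_right_mono add_right_mono of_int_floor_le of_nat_0_le_iff)
        then show ?thesis by (simp add: add_divide_distrib)
      qed
      have "(\<lambda>n. q n r) \<longlonglongrightarrow> r"
      proof (rule tendsto_sandwich[OF _ _ tendsto_const])
        show "(\<lambda>n. r + 1 / real (Suc n)) \<longlonglongrightarrow> r"
          using tendsto_add[OF tendsto_const LIMSEQ_inverse_real_of_nat, of r] by (simp add: field_simps)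
      qed (use gt le in \<open>auto intro!: always_eventually less_imp_le\<close>)
      then have "filterlim (\<lambda>n. q n r) (at_right r) sequentially"
        using gt by (auto simp: filterlim_at intro!: always_eventually)
           (metis less_irrefl)
      moreover have "(x \<longlongrightarrow> x r) (at_right r)"
        using x True by (simp add: cadlag_def)
      ultimately have "(\<lambda>n. x (q n r)) \<longlonglongrightarrow> x r"
        by (rule filterlim_compose[rotated])
      then show ?thesis using True by simp
    qed simp
  next
    fix n
    have "(\<lambda>k :: int. x ((of_int k + 1) / real (Suc n))) \<in> measurable (count_space UNIV) borel"
      by simp
    moreover have "(\<lambda>r. \<lfloor>real (Suc n) * r\<rfloor>) \<in> measurable borel (count_space UNIV)"
      by measurable
    ultimately have "(\<lambda>r. x (q n r)) \<in> borel_measurable borel"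
      unfolding q_def by (rule measurable_compose[rotated])
    then show "(\<lambda>r. indicator {0..} r *\<^sub>R x (q n r)) \<in> borel_measurable borel" by measurable
  qed
  then show ?thesis by (simp add: set_borel_measurable_def)
qed

section \<open>Weighted averages\<close>

lemma set_integrable_mult_bounded:
  fixes w x :: "'a \<Rightarrow> real"
  assumes w: "set_integrable M S w" and x: "set_borel_measurable M S x"
    and bound: "\<And>r. r \<in> S \<Longrightarrow> \<bar>x r\<bar> \<le> B"
  shows "set_integrable M S (\<lambda>r. w r * x r)"
proof (rule set_integrable_bound)
  show "set_integrable M S (\<lambda>r. B * w r)" using w by simp
  have "(\<lambda>r. (indicator S r *\<^sub>R w r) * (indicator S r *\<^sub>R x r)) \<in> borel_measurable M"
    using x borel_measurable_integrable[OF w[unfolded set_integrable_def]]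
    by (intro borel_measurable_times) (auto simp: set_borel_measurable_def)
  moreover have "(\<lambda>r. (indicator S r *\<^sub>R w r) * (indicator S r *\<^sub>R x r))
      = (\<lambda>r. indicator S r *\<^sub>R (w r * x r))"
    by (auto simp: indicator_def)
  ultimately show "set_borel_measurable M S (\<lambda>r. w r * x r)"
    by (simp only: set_borel_measurable_def)
  show "AE r\<in>S in M. norm (w r * x r) \<le> norm (B * w r)"
  proof (intro AE_I2 impI)
    fix r assume "r \<in> S"
    then have "\<bar>x r\<bar> \<le> \<bar>B\<bar>" using bound[of r] by linarith
    then show "norm (w r * x r) \<le> norm (B * w r)"
      using mult_left_mono[of "\<bar>x r\<bar>" "\<bar>B\<bar>" "\<bar>w r\<bar>"] by (simp add: abs_mult mult.commute)
  qed
qed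

text \<open>
  For a nonnegative weight the error made by freezing \<open>x\<close> at \<open>c\<close> is controlled by the integral of
  the weight itself. This turns the signs of the kernels into estimates.
\<close>

lemma weighted_integral_deviation:
  fixes w x :: "'a \<Rightarrow> real"
  assumes w: "set_integrable M S w" "\<And>r. r \<in> S \<Longrightarrow> 0 \<le> w r"
    and x: "set_borel_measurable M S x"
    and near: "\<And>r. r \<in> S \<Longrightarrow> \<bar>x r - c\<bar> \<le> \<epsilon>"
  shows "\<bar>(LINT r:S|M. w r * x r) - c * (LINT r:S|M. w r)\<bar> \<le> \<epsilon> * (LINT r:S|M. w r)"
proof -
  have "\<bar>x r\<bar> \<le> \<bar>c\<bar> + \<epsilon>" if "r \<in> S" for r using near[OF that] by linarith
  then have int: "set_integrable M S (\<lambda>r. w r * x r)"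
    by (intro set_integrable_mult_bounded[OF w(1) x])
  have int': "set_integrable M S (\<lambda>r. w r * x r - c * w r)"
    using int w(1) by (intro set_integral_diff) auto
  have "(LINT r:S|M. w r * x r) - c * (LINT r:S|M. w r) = (LINT r:S|M. w r * x r - c * w r)"
    using int w(1) by (subst set_integral_diff) auto
  also have "\<bar>\<dots>\<bar> \<le> (LINT r:S|M. \<bar>w r * x r - c * w r\<bar>)"
    using set_integral_norm_bound[OF int'] by simp
  also have "\<dots> \<le> (LINT r:S|M. \<epsilon> * w r)"
  proof (rule set_integral_mono)
    show "set_integrable M S (\<lambda>r. \<bar>w r * x r - c * w r\<bar>)"
      using int' by (rule set_integrable_abs)
    fix r assume r: "r \<in> S"
    have "w r * x r - c * w r = (x r - c) * w r" by (simp add: algebra_simps)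
    then have "\<bar>w r * x r - c * w r\<bar> = \<bar>x r - c\<bar> * w r"
      using w(2)[OF r] by (simp add: abs_mult)
    then show "\<bar>w r * x r - c * w r\<bar> \<le> \<epsilon> * w r"
      using mult_right_mono[OF near[OF r] w(2)[OF r]] by simp
  qed (use w in auto)
  finally show ?thesis by simp
qed

section \<open>The two parts of the increment\<close>

context smooth_variation
begin

text \<open>
  At a positive distance from the diagonal the derivative in the first argument is bounded on
  compact sets, and the mean value theorem applies.
\<close>

lemma partial_increment_bound:
  assumes nm: "n + m < 2" and "p < s"
  obtains C where "0 \<le> C" "\<And>h r. 0 < h \<Longrightarrow> h \<le> 1 \<Longrightarrow> a \<le> r \<Longrightarrow> r \<le> p \<Longrightarrow>
     \<bar>partial n m F (s + h) r - partial n m F s r\<bar> \<le> C * h"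
proof -
  let ?K = "{s..s+1} \<times> {a..p}"
  have "compact ((\<lambda>(u, r). partial (Suc n) m F u r) ` ?K)"
    using assms by (intro compact_continuous_image continuous_on_subset[OF partial_continuous])
      (auto simp: dom_E_open_def compact_Times)
  then obtain C where C: "\<forall>u\<in>{s..s+1}. \<forall>r\<in>{a..p}. \<bar>partial (Suc n) m F u r\<bar> \<le> C"
    by (auto dest!: compact_imp_bounded simp: bounded_iff)
  show thesis
  proof (rule that[of "max C 0"])
    fix h r :: real assume h: "0 < h" "h \<le> 1" and r: "a \<le> r" "r \<le> p"
    have "\<exists>z>s. z < s + h \<and> partial n m F (s + h) r - partial n m F s r
        = (s + h - s) * partial (Suc n) m F z r"
      using h r assms by (intro MVT2) (auto intro!: partial_deriv_fst)
    then obtain z where z: "s < z" "z < s + h"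
      "partial n m F (s + h) r - partial n m F s r = h * partial (Suc n) m F z r" by auto
    have "\<bar>partial (Suc n) m F z r\<bar> \<le> max C 0"
      using C[rule_format, of z r] z h r by (intro max.coboundedI1) auto
    then show "\<bar>partial n m F (s + h) r - partial n m F s r\<bar> \<le> max C 0 * h"
      using h mult_left_mono[of _ "max C 0" h] by (simp add: z(3) abs_mult mult.commute)
  qed auto
qed

text \<open>
  The weight \<open>- F01 (s + h)\<close> is nonnegative on \<open>[s, s + h)\<close> with integral exactly \<open>F (s + h) s\<close>, and
  \<open>x\<close> is close to \<open>x s\<close> there by right continuity.
\<close>

lemma recent_past_limit:
  assumes x: "cadlag x" and s: "0 \<le> s"
  shows "((\<lambda>h. (LBINT r:{s..<s+h}. F01 (s + h) r * x r) / F (s + h) s) \<longlongrightarrow> - x s) (at_right 0)"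
proof (rule tendstoI)
  fix e :: real assume e: "0 < e"
  have "\<forall>\<^sub>F r in at_right s. dist (x r) (x s) < e / 2"
    using x s e by (intro tendstoD) (auto simp: cadlag_def)
  then obtain b where b: "s < b" "\<And>r. s < r \<Longrightarrow> r < b \<Longrightarrow> dist (x r) (x s) < e / 2"
    by (auto simp: eventually_at_right_field)
  obtain \<eta> where \<eta>: "0 < \<eta>"
    "\<And>t r. t \<in> {s..s+1} \<Longrightarrow> t - \<eta> < r \<Longrightarrow> r < t \<Longrightarrow> F01 t r < 0"
    using signs_near_diagonal[of "{s..s+1}"] by (metis compact_Icc)
  show "\<forall>\<^sub>F h in at_right 0.
      dist ((LBINT r:{s..<s+h}. F01 (s + h) r * x r) / F (s + h) s) (- x s) < e"
    unfolding eventually_at_right_field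
  proof (intro exI[of _ "min (b - s) (min \<eta> 1)"] conjI allI impI)
    fix h assume "0 < h" "h < min (b - s) (min \<eta> 1)"
    then have h: "0 < h" "s + h < b" "h < \<eta>" "h < 1" by auto
    let ?I = "LBINT r:{s..<s+h}. F01 (s + h) r * x r"
    have Fp: "0 < F (s + h) s" using h by (intro F_pos) auto
    have "\<bar>(LBINT r:{s..<s+h}. - F01 (s + h) r * x r) - x s * (LBINT r:{s..<s+h}. - F01 (s + h) r)\<bar>
        \<le> e / 2 * (LBINT r:{s..<s+h}. - F01 (s + h) r)"
    proof (rule weighted_integral_deviation)
      show "set_integrable lborel {s..<s+h} (\<lambda>r. - F01 (s + h) r)"
        using F01_integral(1)[of s "s + h" "s + h"] h by (simp add: set_integrable_def)
      show "set_borel_measurable lborel {s..<s+h} x"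
        using s by (intro set_borel_measurable_subset[OF cadlag_measurable[OF x]]) auto
      fix r assume r: "r \<in> {s..<s+h}"
      show "0 \<le> - F01 (s + h) r" using \<eta>(2)[of "s + h" r] r h by auto
      show "\<bar>x r - x s\<bar> \<le> e / 2"
        using b(2)[of r] r h e by (cases "r = s") (auto simp: dist_real_def)
    qed
    moreover have "(LBINT r:{s..<s+h}. - F01 (s + h) r * x r) = - ?I"
      by (simp add: set_lebesgue_integral_def)
    moreover have "(LBINT r:{s..<s+h}. - F01 (s + h) r) = - (LBINT r:{s..<s+h}. F01 (s + h) r)"
      by (simp add: set_lebesgue_integral_def)
    then have "(LBINT r:{s..<s+h}. - F01 (s + h) r) = F (s + h) s"
      using F01_integral(2)[of s "s + h" "s + h"] h F_diagonal[of "s + h"] by simp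
    ultimately have "\<bar>- ?I - x s * F (s + h) s\<bar> \<le> e / 2 * F (s + h) s" by (simp only:)
    moreover have "\<bar>I / f + y\<bar> = \<bar>- I - y * f\<bar> / f" if "0 < f" for I f y :: real
    proof -
      have "I / f + y = - (- I - y * f) / f" using that by (simp add: field_simps)
      then show ?thesis using that by (simp only: abs_divide abs_minus_cancel abs_of_pos)
    qed
    from this[OF Fp] have "\<bar>?I / F (s + h) s + x s\<bar> = \<bar>- ?I - x s * F (s + h) s\<bar> / F (s + h) s" .
    ultimately have "\<bar>?I / F (s + h) s + x s\<bar> \<le> e / 2" using Fp by (simp add: pos_divide_le_eq)
    then show "dist (?I / F (s + h) s) (- x s) < e" using e by (simp add: dist_real_def)
  qed (use b \<eta> in auto)
qed

text \<open>
  Choose \<open>p < s\<close> such that \<open>x\<close> is close to its left limit on \<open>[p, s)\<close>. There \<open>F11 > 0\<close> makes the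
  weight \<open>F01 (s + h) r - F01 s r\<close> nonnegative, and its integral is \<open>F (s + h) s\<close> minus
  \<open>F (s + h) p - F s p\<close>. This last increment and the contribution of \<open>[0, p)\<close> are \<open>O(h)\<close>. For
  \<open>s = 0\<close> there is no past, in accordance with \<open>left_limit x 0 = 0\<close>.
\<close>

lemma remote_past_limit:
  assumes x: "cadlag x" and "0 \<le> s"
  shows "((\<lambda>h. (LBINT r:{0..<s}. (F01 (s + h) r - F01 s r) * x r) / F (s + h) s)
    \<longlongrightarrow> left_limit x s) (at_right 0)"
proof (cases "s = 0")
  case True
  then show ?thesis by (simp add: left_limit_def set_lebesgue_integral_def)
next
  case False
  with assms have s: "0 < s" by simp
  define l where "l = left_limit x s"
  show ?thesis unfolding l_def[symmetric]
  proof (rule tendstoI)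
    fix e :: real assume e: "0 < e"
    have "\<forall>\<^sub>F r in at_left s. dist (x r) l < e / 2"
      using cadlag_left_limit[OF x s] e by (intro tendstoD) (auto simp: l_def)
    then obtain b where b: "b < s" "\<And>r. b < r \<Longrightarrow> r < s \<Longrightarrow> dist (x r) l < e / 2"
      by (auto simp: eventually_at_left_field)
    obtain \<eta> where \<eta>: "0 < \<eta>"
      "\<And>t r. t \<in> {s..s+1} \<Longrightarrow> t - \<eta> < r \<Longrightarrow> r < t \<Longrightarrow> 0 < F11 t r"
      using signs_near_diagonal[of "{s..s+1}"] by (metis compact_Icc)
    \<comment> \<open>half of \<open>\<eta>\<close> is kept for \<open>h\<close>: then \<open>u - \<eta> < r\<close> for all \<open>u \<in> {s..s + h}\<close> and \<open>r \<ge> p\<close>\<close>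
    obtain p where "max b (max 0 (s - \<eta> / 2)) < p" "p < s"
      using dense[of "max b (max 0 (s - \<eta> / 2))" s] b s \<eta> by auto
    then have p: "b < p" "0 < p" "s - \<eta> / 2 < p" "p < s" by auto
    obtain B where B: "0 \<le> B" "\<And>r. 0 \<le> r \<Longrightarrow> r \<le> s \<Longrightarrow> \<bar>x r\<bar> \<le> B"
      using cadlag_bounded[OF x] s by (metis less_imp_le)
    obtain C where C: "0 \<le> C" "\<And>h r. 0 < h \<Longrightarrow> h \<le> 1 \<Longrightarrow> 0 \<le> r \<Longrightarrow> r \<le> p \<Longrightarrow>
        \<bar>F01 (s + h) r - F01 s r\<bar> \<le> C * h"
      by (rule partial_increment_bound[of 0 1 p s 0]) (use p in auto)
    obtain D where D: "0 \<le> D" "\<And>h. 0 < h \<Longrightarrow> h \<le> 1 \<Longrightarrow> \<bar>F (s + h) p - F s p\<bar> \<le> D * h"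
    proof (rule partial_increment_bound[of 0 0 p s p])
      fix D :: real assume "0 \<le> D" and D: "\<And>h r. 0 < h \<Longrightarrow> h \<le> 1 \<Longrightarrow> p \<le> r \<Longrightarrow> r \<le> p \<Longrightarrow>
        \<bar>partial 0 0 F (s + h) r - partial 0 0 F s r\<bar> \<le> D * h"
      show thesis
        by (rule that[OF \<open>0 \<le> D\<close>]) (use D[of _ p] in \<open>simp add: partial_def\<close>)
    qed (use p in auto)
    define K where "K = C * B * p + (e / 2 + \<bar>l\<bar>) * D"
    have bound: "\<bar>(LBINT r:{0..<s}. (F01 (s + h) r - F01 s r) * x r) - l * F (s + h) s\<bar>
        \<le> e / 2 * F (s + h) s + K * h" if "0 < h" "h < 1" "h < \<eta> / 2" for h
    proof -
      define w where "w r = F01 (s + h) r - F01 s r" for r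
      have w_int: "set_integrable lborel {a..<b} w"
        "(LBINT r:{a..<b}. w r) = F (s + h) b - F (s + h) a - (F s b - F s a)" if "a \<le> b" "b \<le> s" for a b
        unfolding w_def using that \<open>0 < h\<close> F01_integral[of a b s] F01_integral[of a b "s + h"]
        by (auto simp: set_integral_diff)
      have x_meas: "set_borel_measurable lborel {a..<b} x" if "0 \<le> a" for a b
        using that by (intro set_borel_measurable_subset[OF cadlag_measurable[OF x]]) auto
      have wx_int: "set_integrable lborel {a..<b} (\<lambda>r. w r * x r)" if "0 \<le> a" "a \<le> b" "b \<le> s" for a b
        using that w_int x_meas B by (intro set_integrable_mult_bounded[where B = B]) auto
      have F_incr: "\<bar>F (s + h) p - F s p\<bar> \<le> D * h" using D that by auto
      have W: "(LBINT r:{p..<s}. w r) = F (s + h) s - (F (s + h) p - F s p)"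
        using w_int(2)[of p s] p F_diagonal[of s] by simp
      have near: "\<bar>(LBINT r:{p..<s}. w r * x r) - l * (LBINT r:{p..<s}. w r)\<bar>
          \<le> e / 2 * (LBINT r:{p..<s}. w r)"
      proof (rule weighted_integral_deviation)
        fix r assume r: "r \<in> {p..<s}"
        show "\<bar>x r - l\<bar> \<le> e / 2" using b(2)[of r] r p by (auto simp: dist_real_def)
        have "F01 s r \<le> F01 (s + h) r"
        proof (rule DERIV_nonneg_imp_nondecreasing[where f = "\<lambda>u. F01 u r"])
          fix u assume "s \<le> u" "u \<le> s + h"
          then have "0 < F11 u r" and "r < u" using \<eta>(2)[of u r] r p that by auto
          then show "\<exists>y. ((\<lambda>u. F01 u r) has_real_derivative y) (at u) \<and> 0 \<le> y"
            using F01_deriv_fst by (metis less_imp_le)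
        qed (use that in auto)
        then show "0 \<le> w r" by (simp add: w_def)
      qed (use w_int x_meas p in auto)
      have far: "\<bar>LBINT r:{0..<p}. w r * x r\<bar> \<le> C * B * p * h"
      proof -
        have "\<bar>LBINT r:{0..<p}. w r * x r\<bar> \<le> (LBINT r:{0..<p}. \<bar>w r * x r\<bar>)"
          using set_integral_norm_bound[OF wx_int[of 0 p]] p by simp
        also have "\<dots> \<le> (LBINT r:{0..<p}. C * h * B)"
        proof (rule set_integral_mono)
          show "set_integrable lborel {0..<p} (\<lambda>r. \<bar>w r * x r\<bar>)"
            using p by (intro set_integrable_abs wx_int) auto
          show "set_integrable lborel {0..<p} (\<lambda>r. C * h * B)"
            using p by (auto simp: set_integrable_def intro!: integrable_real_indicator)
          fix r assume "r \<in> {0..<p}"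
          then show "\<bar>w r * x r\<bar> \<le> C * h * B"
            unfolding abs_mult w_def using p that C B by (intro mult_mono) auto
        qed
        also have "\<dots> = C * B * p * h"
          using p by (simp add: set_lebesgue_integral_def)
        finally show ?thesis .
      qed
      have split: "(LBINT r:{0..<s}. w r * x r) = (LBINT r:{0..<p}. w r * x r) + (LBINT r:{p..<s}. w r * x r)"
        using set_integral_Un[of "{0..<p}" "{p..<s}" lborel "\<lambda>r. w r * x r"] wx_int p
        by (simp add: ivl_disj_un_two)
      have "\<bar>l * (F (s + h) p - F s p)\<bar> \<le> \<bar>l\<bar> * (D * h)"
        unfolding abs_mult using F_incr by (intro mult_left_mono) auto
      moreover have "e / 2 * (LBINT r:{p..<s}. w r) \<le> e / 2 * (F (s + h) s + D * h)"
        using F_incr e by (intro mult_left_mono) (auto simp: W)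
      moreover have "l * (LBINT r:{p..<s}. w r) = l * F (s + h) s - l * (F (s + h) p - F s p)"
        by (simp add: W algebra_simps)
      ultimately have "\<bar>(LBINT r:{0..<s}. w r * x r) - l * F (s + h) s\<bar>
          \<le> C * B * p * h + e / 2 * (F (s + h) s + D * h) + \<bar>l\<bar> * (D * h)"
        using near far unfolding split by linarith
      also have "\<dots> = e / 2 * F (s + h) s + K * h" by (simp add: K_def algebra_simps)
      finally show ?thesis by (simp add: w_def)
    qed
    have "\<forall>\<^sub>F h in at_right 0. K * (h / F (s + h) s) < e / 2"
      using tendsto_mult[OF tendsto_const increment_negligible, of K s] e
      by (intro order_tendstoD(2)[of _ 0]) auto
    moreover have "\<forall>\<^sub>F h in at_right 0. 0 < h \<and> h < min 1 (\<eta> / 2)"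
      using \<eta>(1) by (auto simp: eventually_at_right_field intro!: exI[of _ "min 1 (\<eta> / 2)"])
    ultimately show "\<forall>\<^sub>F h in at_right 0.
        dist ((LBINT r:{0..<s}. (F01 (s + h) r - F01 s r) * x r) / F (s + h) s) l < e"
    proof eventually_elim
      case (elim h)
      let ?I = "LBINT r:{0..<s}. (F01 (s + h) r - F01 s r) * x r"
      have Fp: "0 < F (s + h) s" using elim by (intro F_pos) auto
      have "?I / F (s + h) s - l = (?I - l * F (s + h) s) / F (s + h) s"
        using Fp by (simp add: field_simps)
      then have "\<bar>?I / F (s + h) s - l\<bar> = \<bar>?I - l * F (s + h) s\<bar> / F (s + h) s"
        using Fp by (simp only: abs_divide abs_of_pos)
      also have "\<dots> \<le> (e / 2 * F (s + h) s + K * h) / F (s + h) s"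
        using bound[of h] elim Fp by (intro divide_right_mono) auto
      also have "\<dots> = e / 2 + K * (h / F (s + h) s)" using Fp by (simp add: field_simps)
      also have "\<dots> < e" using elim(1) by linarith
      finally show ?case by (simp add: dist_real_def)
    qed
  qed
qed

lemma pathwise_jump_limit:
  assumes x: "cadlag x" and s: "0 \<le> s"
    and m: "\<And>t. 0 \<le> t \<Longrightarrow> m t = - (LBINT r:{0..<t}. F01 t r * x r)"
  shows "((\<lambda>h. (m (s + h) - m s) / F (s + h) s) \<longlongrightarrow> jump x s) (at_right 0)"
proof -
  let ?R = "\<lambda>h. LBINT r:{s..<s+h}. F01 (s + h) r * x r"
  let ?L = "\<lambda>h. LBINT r:{0..<s}. (F01 (s + h) r - F01 s r) * x r"
  have int: "set_integrable lborel {a..<b} (\<lambda>r. F01 t r * x r)" if "0 \<le> a" "a \<le> b" "b \<le> t" for a b t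
  proof -
    obtain B where "\<And>r. 0 \<le> r \<Longrightarrow> r \<le> b \<Longrightarrow> \<bar>x r\<bar> \<le> B"
      using cadlag_bounded[OF x, of b] that by (metis order_trans)
    then show ?thesis
      using that
      by (intro set_integrable_mult_bounded[where B = B] F01_integral(1)
            set_borel_measurable_subset[OF cadlag_measurable[OF x]]) auto
  qed
  have eq: "(m (s + h) - m s) / F (s + h) s = - (?R h / F (s + h) s) - ?L h / F (s + h) s"
    if "0 < h" for h
  proof -
    have "(LBINT r:{0..<s+h}. F01 (s + h) r * x r) = (LBINT r:{0..<s}. F01 (s + h) r * x r) + ?R h"
      using set_integral_Un[of "{0..<s}" "{s..<s+h}" lborel "\<lambda>r. F01 (s + h) r * x r"] that s int
      by (simp add: ivl_disj_un_two)
    moreover have "?L h = (LBINT r:{0..<s}. F01 (s + h) r * x r) - (LBINT r:{0..<s}. F01 s r * x r)"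
      using that s int by (simp add: left_diff_distrib set_integral_diff)
    ultimately show ?thesis
      using m[of s] m[of "s + h"] s that by (simp add: diff_divide_distrib add_divide_distrib)
  qed
  have "((\<lambda>h. - (?R h / F (s + h) s) - ?L h / F (s + h) s) \<longlongrightarrow> - (- x s) - left_limit x s) (at_right 0)"
    by (intro tendsto_intros recent_past_limit remote_past_limit assms)
  then have "((\<lambda>h. - (?R h / F (s + h) s) - ?L h / F (s + h) s) \<longlongrightarrow> jump x s) (at_right 0)"
    by (simp add: jump_def)
  then show ?thesis
    by (rule Lim_transform_eventually)
       (auto simp: eventually_at_right_field eq intro!: exI[of _ 1])
qed

end

section \<open>Jumps as limits of fractional increments\<close>

theorem theorem1p4:
  fixes P :: "'a measure"
    and \<F> :: "real \<Rightarrow> 'a measure"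
    and X M :: "real \<Rightarrow> 'a \<Rightarrow> real"
    and F :: "real \<Rightarrow> real \<Rightarrow> real"
    and d :: real
  assumes "0 < d" and "d < 1"
    and "F \<in> SR2 d"
    and "filtered_prob_space P \<F>"
    and "semimartingale P \<F> X"
    and "AE \<omega> in P. X 0 \<omega> = 0"
    and M_integral: "\<And>t. 0 \<le> t \<Longrightarrow> is_stoch_integral P \<F> X (\<lambda>r \<omega>. F t r) t (M t)"
    and M_version: "AE \<omega> in P. \<forall>t\<ge>0.
          M t \<omega> = - (LBINT r:{0..<t}. partial 0 1 F t r * X r \<omega>)"
  shows "AE \<omega> in P. \<forall>s\<in>{0..1}.
           ((\<lambda>h. (M (s + h) \<omega> - M s \<omega>) / F (s + h) s) \<longlongrightarrow> jump (\<lambda>t. X t \<omega>) s) (at_right 0)"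
proof -
  interpret smooth_variation F d
    using assms by unfold_locales
  have "AE \<omega> in P. cadlag (\<lambda>t. X t \<omega>)"
    using assms(5) by (simp add: semimartingale_def)
  with M_version show ?thesis
  proof eventually_elim
    case (elim \<omega>)
    then show ?case by (intro ballI pathwise_jump_limit) auto
  qed
qed

end
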